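(* Let $G \in \sigma\mathcal F$ and suppose that Eve does not have a winning strategy in the game $\mathrm{BM}(\mathcal F, G)$. Then $G$ is weakly $\mathcal F$-injective.
   Context: Fix a countable first-order signature. $\mathcal F$ is a class, closed under isomorphisms, of countable finitely generated structures in this signature. $X \leq Y$ means that $X$ is a substructure of $Y$. $\sigma\mathcal F$ is the class of all structures of the form $\bigcup_{n\in\omega} X_n$, where $X_0 \leq X_1 \leq X_2 \leq \cdots$ is a chain of structures from $\mathcal F$. The game $\mathrm{BM}(\mathcal F, G)$: two players, Eve and Odd, alternately build a chain $A_0 \leq A_1 \leq A_2 \leq \cdots$ of structures from $\mathcal F$. Eve starts by choosing $A_0 \in \mathcal F$; Odd responds with $A_1 \in \mathcal F$, $A_1 \geq A_0$; Eve responds with $A_2 \in \mathcal F$, $A_2 \geq A_1$; and so on (Eve chooses $A_n$ for even $n$, Odd for odd $n$). Odd wins if $A_\infty = \bigcup_{n\in\omega} A_n$ is isomorphic to $G$; otherwise Eve wins. A strategy prescribes a player's move as a function of the finite sequence of previous moves; it is winning if the player wins every play in which it is followed. A structure $G \in \sigma\mathcal F$ is weakly $\mathcal F$-injective if every structure from $\mathcal F$ embeds into $G$ and, for every $A \leq G$ with $A \in \mathcal F$, there is $B \in \mathcal F$ such that $A \leq B \leq G$ and for every $X \in \mathcal F$ with $B \leq X$ there exists an embedding $f\colon X \to G$ with $f\restriction A = \mathrm{id}_A$. *)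

theory Defs
  imports Main "HOL-Library.FuncSet" "HOL-Library.Countable_Set"
begin

section \<open>Signatures and structures\<close>

text \<open>Constants are function symbols of arity 0.\<close>

record ('f, 'r) signature =
  funs :: "'f set"
  rels :: "'r set"
  far :: "'f \<Rightarrow> nat"
  rar :: "'r \<Rightarrow> nat"

text \<open>
  Carriers are subsets of a type \<open>'a\<close>, which plays the role of the set-theoretic universe; so
  ``closed under isomorphisms'' and ``for every \<open>X \<ge> B\<close>'' range over structures with carrier in
  \<open>'a\<close>. All structures involved are countable, so nothing is lost once
  \<open>uncountable (UNIV :: 'a set)\<close> is assumed:
  every countable structure then has a copy in \<open>'a\<close>, and every countable extension of a countable
  structure in \<open>'a\<close> is realised in \<open>'a\<close> over that structure. Over a countable type this fails,
  since a structure occupying all of \<open>'a\<close> has no proper extension.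
\<close>

record ('f, 'r, 'a) struct =
  carrier :: "'a set"
  fint :: "'f \<Rightarrow> 'a list \<Rightarrow> 'a"
  rint :: "'r \<Rightarrow> 'a list set"

definition countable_signature :: "('f, 'r) signature \<Rightarrow> bool" where
  "countable_signature L \<longleftrightarrow> countable (funs L) \<and> countable (rels L)"

definition tuples :: "nat \<Rightarrow> 'a set \<Rightarrow> 'a list set" where
  "tuples n A = {xs. length xs = n \<and> set xs \<subseteq> A}"

text \<open>
  Interpretations are required to be extensional (undefined off the symbols of the signature
  and off the tuples from the carrier), so that equality of records is equality of
  structures. The carrier may be empty.
\<close>

definition is_struct :: "('f, 'r) signature \<Rightarrow> ('f, 'r, 'a) struct \<Rightarrow> bool" where
  "is_struct L X \<longleftrightarrow>
     fint X \<in> (\<Pi>\<^sub>E f\<in>funs L. tuples (far L f) (carrier X) \<rightarrow>\<^sub>E carrier X) \<and>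
     rint X \<in> (\<Pi>\<^sub>E r\<in>rels L. Pow (tuples (rar L r) (carrier X)))"

definition substructure ::
    "('f, 'r) signature \<Rightarrow> ('f, 'r, 'a) struct \<Rightarrow> ('f, 'r, 'a) struct \<Rightarrow> bool" where
  "substructure L X Y \<longleftrightarrow>
     is_struct L X \<and> is_struct L Y \<and> carrier X \<subseteq> carrier Y \<and>
     (\<forall>f\<in>funs L. \<forall>xs\<in>tuples (far L f) (carrier X). fint X f xs = fint Y f xs) \<and>
     (\<forall>r\<in>rels L. \<forall>xs\<in>tuples (rar L r) (carrier X). xs \<in> rint X r \<longleftrightarrow> xs \<in> rint Y r)"

definition embedding ::
    "('f, 'r) signature \<Rightarrow> ('f, 'r, 'a) struct \<Rightarrow> ('f, 'r, 'a) struct \<Rightarrow> ('a \<Rightarrow> 'a) \<Rightarrow> bool" where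
  "embedding L X Y h \<longleftrightarrow>
     is_struct L X \<and> is_struct L Y \<and> h ` carrier X \<subseteq> carrier Y \<and> inj_on h (carrier X) \<and>
     (\<forall>f\<in>funs L. \<forall>xs\<in>tuples (far L f) (carrier X). h (fint X f xs) = fint Y f (map h xs)) \<and>
     (\<forall>r\<in>rels L. \<forall>xs\<in>tuples (rar L r) (carrier X). xs \<in> rint X r \<longleftrightarrow> map h xs \<in> rint Y r)"

definition isomorphic ::
    "('f, 'r) signature \<Rightarrow> ('f, 'r, 'a) struct \<Rightarrow> ('f, 'r, 'a) struct \<Rightarrow> bool" where
  "isomorphic L X Y \<longleftrightarrow> (\<exists>h. embedding L X Y h \<and> h ` carrier X = carrier Y)"

definition finitely_generated :: "('f, 'r) signature \<Rightarrow> ('f, 'r, 'a) struct \<Rightarrow> bool" where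
  "finitely_generated L X \<longleftrightarrow>
     (\<exists>S. finite S \<and> S \<subseteq> carrier X \<and> (\<forall>Y. substructure L Y X \<and> S \<subseteq> carrier Y \<longrightarrow> Y = X))"

definition fg_class :: "('f, 'r) signature \<Rightarrow> ('f, 'r, 'a) struct set \<Rightarrow> bool" where
  "fg_class L F \<longleftrightarrow>
     (\<forall>X\<in>F. is_struct L X \<and> countable (carrier X) \<and> finitely_generated L X) \<and>
     (\<forall>X\<in>F. \<forall>Y. isomorphic L X Y \<longrightarrow> Y \<in> F)"

section \<open>Chains and their unions\<close>

definition is_chain ::
    "('f, 'r) signature \<Rightarrow> ('f, 'r, 'a) struct set \<Rightarrow> (nat \<Rightarrow> ('f, 'r, 'a) struct) \<Rightarrow> bool" where
  "is_chain L F A \<longleftrightarrow> (\<forall>n. A n \<in> F \<and> substructure L (A n) (A (Suc n)))"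

text \<open>
  Functions are evaluated in the first member of the chain containing all arguments; along a
  chain, every later member gives the same value.
\<close>

definition chain_union ::
    "('f, 'r) signature \<Rightarrow> (nat \<Rightarrow> ('f, 'r, 'a) struct) \<Rightarrow> ('f, 'r, 'a) struct" where
  "chain_union L A =
     \<lparr>carrier = (\<Union>n. carrier (A n)),
      fint = (\<lambda>f\<in>funs L. \<lambda>xs\<in>tuples (far L f) (\<Union>n. carrier (A n)).
                fint (A (LEAST n. set xs \<subseteq> carrier (A n))) f xs),
      rint = (\<lambda>r\<in>rels L. \<Union>n. rint (A n) r)\<rparr>"

definition sigma_class ::
    "('f, 'r) signature \<Rightarrow> ('f, 'r, 'a) struct set \<Rightarrow> ('f, 'r, 'a) struct set" where
  "sigma_class L F = {chain_union L A | A. is_chain L F A}"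

section \<open>The game\<close>

definition position ::
    "('f, 'r) signature \<Rightarrow> ('f, 'r, 'a) struct set \<Rightarrow> ('f, 'r, 'a) struct list \<Rightarrow> bool" where
  "position L F xs \<longleftrightarrow> set xs \<subseteq> F \<and> successively (substructure L) xs"

text \<open>
  A strategy has to answer every position in which Eve is to move with a legal move; otherwise
  a strategy followed in no play at all would be vacuously winning.
\<close>

definition eve_strategy ::
    "('f, 'r) signature \<Rightarrow> ('f, 'r, 'a) struct set \<Rightarrow>
     (('f, 'r, 'a) struct list \<Rightarrow> ('f, 'r, 'a) struct) \<Rightarrow> bool" where
  "eve_strategy L F s \<longleftrightarrow>
     (\<forall>xs. position L F xs \<and> even (length xs) \<longrightarrow> position L F (xs @ [s xs]))"

definition eve_follows ::
    "(('f, 'r, 'a) struct list \<Rightarrow> ('f, 'r, 'a) struct) \<Rightarrow> (nat \<Rightarrow> ('f, 'r, 'a) struct) \<Rightarrow> bool" where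
  "eve_follows s A \<longleftrightarrow> (\<forall>n. even n \<longrightarrow> A n = s (map A [0..<n]))"

definition odd_wins ::
    "('f, 'r) signature \<Rightarrow> ('f, 'r, 'a) struct \<Rightarrow> (nat \<Rightarrow> ('f, 'r, 'a) struct) \<Rightarrow> bool" where
  "odd_wins L G A \<longleftrightarrow> isomorphic L (chain_union L A) G"

definition eve_winning_strategy ::
    "('f, 'r) signature \<Rightarrow> ('f, 'r, 'a) struct set \<Rightarrow> ('f, 'r, 'a) struct \<Rightarrow>
     (('f, 'r, 'a) struct list \<Rightarrow> ('f, 'r, 'a) struct) \<Rightarrow> bool" where
  "eve_winning_strategy L F G s \<longleftrightarrow>
     eve_strategy L F s \<and> (\<forall>A. is_chain L F A \<and> eve_follows s A \<longrightarrow> \<not> odd_wins L G A)"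

section \<open>Weak injectivity\<close>

definition weakly_injective ::
    "('f, 'r) signature \<Rightarrow> ('f, 'r, 'a) struct set \<Rightarrow> ('f, 'r, 'a) struct \<Rightarrow> bool" where
  "weakly_injective L F G \<longleftrightarrow>
     G \<in> sigma_class L F \<and>
     (\<forall>X\<in>F. \<exists>h. embedding L X G h) \<and>
     (\<forall>A\<in>F. substructure L A G \<longrightarrow>
        (\<exists>B\<in>F. substructure L A B \<and> substructure L B G \<and>
           (\<forall>X\<in>F. substructure L B X \<longrightarrow>
              (\<exists>h. embedding L X G h \<and> (\<forall>a\<in>carrier A. h a = a)))))"

end

theory Submission
  imports Defs
begin

text \<open>
  If some \<open>X \<in> F\<close> does not embed into \<open>G\<close>, Eve wins by opening with \<open>X\<close>. Otherwise let \<open>A \<le> G\<close>,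
  generated by the tuple \<open>ss\<close>, witness that \<open>G\<close> is not weakly injective. An isomorphism from the
  final union onto \<open>G\<close> need not fix \<open>A\<close>, so Eve considers every tuple \<open>ys\<close> of elements
  played during the game, one per move, and moves to some \<open>Y \<in> F\<close> having no embedding into \<open>G\<close>
  that sends \<open>ys\<close> to \<open>ss\<close>. Such \<open>Y\<close> exists: if \<open>g\<close> embeds the current structure \<open>C\<close> into
  \<open>G\<close> with \<open>g ys = ss\<close>, then \<open>A \<le> g C \<le> G\<close>, some \<open>X \<in> F\<close> above \<open>g C\<close> does not embed into \<open>G\<close>
  over \<open>A\<close>, and pulling \<open>X\<close> back along \<open>g\<close> gives \<open>Y\<close>. An isomorphism \<open>f\<close> from the union onto \<open>G\<close>
  would contradict the move made for the tuple of \<open>f\<close>-preimages of \<open>ss\<close>.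
\<close>

section \<open>Substructures and embeddings\<close>

lemma tuples_mono: "A \<subseteq> B \<Longrightarrow> xs \<in> tuples n A \<Longrightarrow> xs \<in> tuples n B"
  by (auto simp: tuples_def)

lemma map_tuples: "xs \<in> tuples n A \<Longrightarrow> h ` A \<subseteq> B \<Longrightarrow> map h xs \<in> tuples n B"
  by (auto simp: tuples_def)

lemma fint_closed:
  "is_struct L X \<Longrightarrow> f \<in> funs L \<Longrightarrow> xs \<in> tuples (far L f) (carrier X) \<Longrightarrow> fint X f xs \<in> carrier X"
  by (auto simp: is_struct_def PiE_iff)

lemma rint_tuples:
  "is_struct L X \<Longrightarrow> r \<in> rels L \<Longrightarrow> xs \<in> rint X r \<Longrightarrow> xs \<in> tuples (rar L r) (carrier X)"
  by (auto simp: is_struct_def PiE_iff)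

lemma substructure_refl: "is_struct L X \<Longrightarrow> substructure L X X"
  by (simp add: substructure_def)

lemma substructure_trans: "substructure L X Y \<Longrightarrow> substructure L Y Z \<Longrightarrow> substructure L X Z"
  unfolding substructure_def using tuples_mono[of "carrier X" "carrier Y"] by auto

lemma substructure_of_common:
  "substructure L X Z \<Longrightarrow> substructure L Y Z \<Longrightarrow> carrier X \<subseteq> carrier Y \<Longrightarrow> substructure L X Y"
  unfolding substructure_def using tuples_mono[of "carrier X" "carrier Y"] by auto

text \<open>Maps are total on the universe, but every clause of \<open>embedding\<close> evaluates
  them on the carrier of \<open>X\<close> only, since the interpretations of \<open>X\<close> stay
  inside it.\<close>

lemma embedding_cong:
  assumes "embedding L X Y h" and eq: "\<And>x. x \<in> carrier X \<Longrightarrow> h x = k x"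
  shows "embedding L X Y k"
proof -
  have m: "map h xs = map k xs" if "xs \<in> tuples n (carrier X)" for n xs
    using that eq by (auto simp: tuples_def)
  have "k ` carrier X = h ` carrier X" "inj_on k (carrier X) = inj_on h (carrier X)"
    using eq by (auto intro!: image_cong inj_on_cong)
  then show ?thesis
    using assms(1) m unfolding embedding_def
    by (auto simp: eq[symmetric] fint_closed)
qed

text \<open>Turns restriction and extension of embeddings along substructures into instances of
  composition.\<close>

lemma substructure_iff_embedding_id: "substructure L X Y \<longleftrightarrow> embedding L X Y (\<lambda>x. x)"
  by (auto simp: substructure_def embedding_def)

lemma embedding_comp:
  assumes "embedding L X Y h" "embedding L Y Z k"
  shows "embedding L X Z (\<lambda>x. k (h x))"
proof -
  have t: "map h xs \<in> tuples n (carrier Y)" if "xs \<in> tuples n (carrier X)" for n xs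
    using that assms(1) by (intro map_tuples) (auto simp: embedding_def)
  have mm: "map (\<lambda>x. k (h x)) xs = map k (map h xs)" for xs by simp
  have "inj_on (\<lambda>x. k (h x)) (carrier X)"
    using assms by (auto simp: embedding_def intro!: inj_onI dest!: inj_onD)
  moreover have "k ` h ` carrier X \<subseteq> carrier Z"
    using assms unfolding embedding_def by (meson image_mono order_trans)
  ultimately show ?thesis
    using assms t fint_closed unfolding embedding_def mm by (simp add: image_image del: map_map)
qed

lemma embedding_substructure:
  "substructure L X Y \<Longrightarrow> embedding L Y Z h \<Longrightarrow> embedding L X Z h"
  using embedding_comp[of L X Y "\<lambda>x. x" Z h] by (simp add: substructure_iff_embedding_id)

lemma embedding_into_superstructure:
  "embedding L X Y h \<Longrightarrow> substructure L Y Z \<Longrightarrow> embedding L X Z h"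
  using embedding_comp[of L X Y h Z "\<lambda>x. x"] by (simp add: substructure_iff_embedding_id)

lemma embedding_inv:
  assumes e: "embedding L X Y h" and s: "h ` carrier X = carrier Y"
  shows "embedding L Y X (inv_into (carrier X) h)"
proof -
  let ?k = "inv_into (carrier X) h"
  have inj: "inj_on h (carrier X)" and X: "is_struct L X" and Y: "is_struct L Y"
    using e by (auto simp: embedding_def)
  have k: "?k ` carrier Y \<subseteq> carrier X" "inj_on ?k (carrier Y)"
    using s by (auto intro: inv_into_into inj_on_inv_into)
  have t: "map ?k xs \<in> tuples n (carrier X)" if "xs \<in> tuples n (carrier Y)" for n xs
    using that k(1) by (rule map_tuples)
  have hk: "map h (map ?k xs) = xs" if "xs \<in> tuples n (carrier Y)" for n xs
    using that s by (auto simp: tuples_def f_inv_into_f intro!: map_idI)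
  have "?k (fint Y f xs) = fint X f (map ?k xs)"
    if "f \<in> funs L" "xs \<in> tuples (far L f) (carrier Y)" for f xs
  proof -
    have "h (fint X f (map ?k xs)) = fint Y f xs"
      using e that t[OF that(2)] hk[OF that(2)] unfolding embedding_def by metis
    then show ?thesis
      using inv_into_f_f[OF inj fint_closed[OF X that(1) t[OF that(2)]]] by simp
  qed
  moreover have "xs \<in> rint Y r \<longleftrightarrow> map ?k xs \<in> rint X r"
    if "r \<in> rels L" "xs \<in> tuples (rar L r) (carrier Y)" for r xs
    using e that t[OF that(2)] hk[OF that(2)] unfolding embedding_def by metis
  ultimately show ?thesis
    using X Y k by (simp add: embedding_def)
qed

section \<open>Transport along injections, images and pullbacks\<close>

lemma transport_structure:
  assumes X: "is_struct L X" and inj: "inj_on h (carrier X)"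
  obtains Y where "embedding L X Y h" "carrier Y = h ` carrier X"
proof -
  let ?k = "inv_into (carrier X) h"
  let ?D = "h ` carrier X"
  \<comment> \<open>Arguments are pulled back to \<open>X\<close> by \<open>?k\<close>, evaluated
    there and pushed forward; the restricted abstractions make the interpretations
    extensional.\<close>
  define Y :: "('a, 'b, 'c) struct" where
    "Y = \<lparr>carrier = ?D,
          fint = (\<lambda>f\<in>funs L. \<lambda>xs\<in>tuples (far L f) ?D. h (fint X f (map ?k xs))),
          rint = (\<lambda>r\<in>rels L. map h ` rint X r)\<rparr>"
  have t: "map ?k xs \<in> tuples n (carrier X)" if "xs \<in> tuples n ?D" for n xs
    using that by (rule map_tuples) (auto intro: inv_into_into)
  have t': "map h xs \<in> tuples n ?D" if "xs \<in> tuples n (carrier X)" for n xs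
    using that by (rule map_tuples) auto
  have kh: "map ?k (map h xs) = xs" if "xs \<in> tuples n (carrier X)" for n xs
    using that inj by (auto simp: tuples_def intro!: map_idI inv_into_f_f)
  have "is_struct L Y"
    using fint_closed[OF X _ t] t' rint_tuples[OF X]
    by (auto simp: is_struct_def Y_def)
  moreover have "h (fint X f xs) = fint Y f (map h xs)"
    if "f \<in> funs L" "xs \<in> tuples (far L f) (carrier X)" for f xs
    using that t' kh by (simp add: Y_def del: map_map)
  moreover have "xs \<in> rint X r \<longleftrightarrow> map h xs \<in> rint Y r"
    if r: "r \<in> rels L" and xs: "xs \<in> tuples (rar L r) (carrier X)" for r xs
  proof -
    have "ys = xs" if "map h ys = map h xs" "ys \<in> rint X r" for ys
      using kh[OF xs] kh[OF rint_tuples[OF X r that(2)]] that(1) by metis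
    then show ?thesis using r by (auto simp: Y_def)
  qed
  ultimately have "embedding L X Y h"
    using X inj by (simp add: embedding_def Y_def)
  then show ?thesis by (rule that) (simp add: Y_def)
qed

lemma substructure_on_closed_subset:
  assumes X: "is_struct L X" and D: "D \<subseteq> carrier X"
    and closed: "\<And>f xs. f \<in> funs L \<Longrightarrow> xs \<in> tuples (far L f) D \<Longrightarrow> fint X f xs \<in> D"
  obtains Y where "substructure L Y X" "carrier Y = D"
proof
  let ?Y = "\<lparr>carrier = D,
      fint = (\<lambda>f\<in>funs L. \<lambda>xs\<in>tuples (far L f) D. fint X f xs),
      rint = (\<lambda>r\<in>rels L. rint X r \<inter> tuples (rar L r) D)\<rparr>"
  show "substructure L ?Y X"
    using X D closed by (auto simp: substructure_def is_struct_def)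
qed simp

text \<open>The copy of \<open>C\<close> on the image of \<open>g\<close> lies in \<open>G\<close>
  as a substructure because its inclusion factors as the inverse of \<open>g\<close> followed by
  \<open>g\<close>.\<close>

lemma image_substructure:
  assumes g: "embedding L C G g"
  obtains B where "substructure L B G" "embedding L C B g" "carrier B = g ` carrier C"
proof -
  have "is_struct L C" "inj_on g (carrier C)"
    using g by (auto simp: embedding_def)
  then obtain B where B: "embedding L C B g" "carrier B = g ` carrier C"
    by (rule transport_structure)
  have "embedding L B G (\<lambda>x. g (inv_into (carrier C) g x))"
    using embedding_comp[OF embedding_inv[OF B(1)] g] B(2) by simp
  then have "embedding L B G (\<lambda>x. x)"
    by (rule embedding_cong) (simp add: B(2) f_inv_into_f)
  then show ?thesis
    using B by (intro that) (simp_all add: substructure_iff_embedding_id)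
qed

text \<open>Uncountability of the universe provides the new names for the elements of \<open>X\<close> outside \<open>B\<close>.\<close>

lemma pullback_extension:
  fixes C B X :: "('f, 'r, 'a) struct"
  assumes U: "uncountable (UNIV :: 'a set)"
    and cC: "countable (carrier C)" and cX: "countable (carrier X)"
    and g: "embedding L C B g" and gB: "carrier B = g ` carrier C" and BX: "substructure L B X"
  obtains Y t where "embedding L X Y t" "carrier Y = t ` carrier X" "substructure L C Y"
    "\<And>c. c \<in> carrier C \<Longrightarrow> t (g c) = c"
proof -
  have inj: "inj_on g (carrier C)" using g by (simp add: embedding_def)
  have "uncountable (UNIV - carrier C)"
    using U cC by (simp add: uncountable_minus_countable)
  then obtain e :: "nat \<Rightarrow> 'a" where e: "inj e" "range e \<subseteq> UNIV - carrier C"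
    by (meson infinite_countable_subset uncountable_infinite)
  define t where
    "t x = (if x \<in> carrier B then inv_into (carrier C) g x else e (to_nat_on (carrier X) x))" for x
  have tg: "t (g c) = c" if "c \<in> carrier C" for c
    using that inj by (simp add: t_def gB)
  have tB: "t x \<in> carrier C" if "x \<in> carrier B" for x
    using that tg by (auto simp: gB)
  have "inj_on t (carrier X)"
  proof (rule inj_onI)
    fix x y assume xy: "x \<in> carrier X" "y \<in> carrier X" "t x = t y"
    \<comment> \<open>The values of \<open>e\<close> avoid \<open>C\<close>, while \<open>t\<close>
      maps \<open>B\<close> into \<open>C\<close>. Hence the two branches of \<open>t\<close> never
      collide and injectivity can be checked on each separately.\<close>
    have *: "t z \<notin> carrier C" if "z \<notin> carrier B" for z
      using e(2) that by (auto simp: t_def)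
    show "x = y"
    proof (cases "x \<in> carrier B")
      case True
      then have "y \<in> carrier B" using * tB xy(3) by metis
      with True xy(3) tg show ?thesis by (auto simp: gB)
    next
      case False
      then have "y \<notin> carrier B" using * tB xy(3) by metis
      with False xy(3) e(1) have "to_nat_on (carrier X) x = to_nat_on (carrier X) y"
        by (auto simp: t_def dest: injD)
      then show ?thesis using xy(1,2) cX by simp
    qed
  qed
  moreover have "is_struct L X" using BX by (simp add: substructure_def)
  ultimately obtain Y where Y: "embedding L X Y t" "carrier Y = t ` carrier X"
    using transport_structure by metis
  have "embedding L C Y (\<lambda>c. t (g c))"
    using embedding_comp[OF embedding_into_superstructure[OF g BX] Y(1)] .
  then have "substructure L C Y"
    unfolding substructure_iff_embedding_id by (rule embedding_cong) (rule tg)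
  then show ?thesis using Y tg that by blast
qed

section \<open>Generators\<close>

text \<open>Exposes the generating set that \<open>finitely_generated\<close> hides behind an
  existential, so that one choice of generators can be kept fixed.\<close>

definition generates :: "('f, 'r) signature \<Rightarrow> ('f, 'r, 'a) struct \<Rightarrow> 'a set \<Rightarrow> bool" where
  "generates L X S \<longleftrightarrow>
     S \<subseteq> carrier X \<and> (\<forall>Y. substructure L Y X \<and> S \<subseteq> carrier Y \<longrightarrow> Y = X)"

text \<open>Serves as structural induction over generated elements: a closed \<open>D\<close>
  carries a substructure containing \<open>S\<close>, to which minimality applies.\<close>

lemma generates_closed_subset:
  assumes "generates L X S" "is_struct L X" "S \<subseteq> D" "D \<subseteq> carrier X"
    and "\<And>f xs. f \<in> funs L \<Longrightarrow> xs \<in> tuples (far L f) D \<Longrightarrow> fint X f xs \<in> D"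
  shows "D = carrier X"
  using substructure_on_closed_subset[OF assms(2,4,5)] assms(1,3)
  unfolding generates_def by metis

text \<open>The intersection of the carriers is closed under the functions, which \<open>A\<close>
  and \<open>B\<close> both inherit from \<open>G\<close>, and contains the generators.\<close>

lemma generated_substructure:
  assumes gen: "generates L A S" and A: "substructure L A G" and B: "substructure L B G"
    and S: "S \<subseteq> carrier B"
  shows "substructure L A B"
proof -
  have "carrier A \<inter> carrier B = carrier A"
  proof (rule generates_closed_subset[OF gen])
    fix f xs assume f: "f \<in> funs L" and xs: "xs \<in> tuples (far L f) (carrier A \<inter> carrier B)"
    have "xs \<in> tuples (far L f) (carrier A)" "xs \<in> tuples (far L f) (carrier B)"
      using xs by (auto simp: tuples_def)
    then show "fint A f xs \<in> carrier A \<inter> carrier B"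
      using A B f fint_closed[of L A f xs] fint_closed[of L B f xs]
      by (auto simp: substructure_def)
  qed (use gen S A in \<open>auto simp: generates_def substructure_def\<close>)
  then show ?thesis using substructure_of_common[OF A B] by auto
qed

text \<open>The fixed points of \<open>h\<close> in \<open>A\<close> are closed under the functions:
  \<open>A\<close> and \<open>G\<close> interpret them alike on \<open>A\<close>, and
  \<open>h\<close> commutes with them.\<close>

lemma embedding_fixing_generators:
  assumes gen: "generates L A S" and A: "substructure L A G" and h: "embedding L A G h"
    and S: "\<forall>s\<in>S. h s = s"
  shows "\<forall>a\<in>carrier A. h a = a"
proof -
  let ?D = "{a \<in> carrier A. h a = a}"
  have "?D = carrier A"
  proof (rule generates_closed_subset[OF gen])
    fix f xs assume f: "f \<in> funs L" and xs: "xs \<in> tuples (far L f) ?D"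
    have xs': "xs \<in> tuples (far L f) (carrier A)" "map h xs = xs"
      using xs by (auto simp: tuples_def intro!: map_idI)
    then show "fint A f xs \<in> ?D"
      using A h f fint_closed[of L A f xs] by (auto simp: substructure_def embedding_def)
  qed (use gen S A in \<open>auto simp: generates_def substructure_def\<close>)
  then show ?thesis by blast
qed

section \<open>Chains\<close>

lemma chain_substructure:
  assumes "is_chain L F A" "m \<le> n"
  shows "substructure L (A m) (A n)"
  using assms(2)
proof (induction n rule: dec_induct)
  case base
  then show ?case using assms(1) by (auto simp: is_chain_def substructure_def)
next
  case (step n)
  then show ?case using assms(1) substructure_trans by (metis is_chain_def)
qed

text \<open>Members of a chain are comparable, so finitely many indices can be replaced by their
  maximum. This is applied to argument tuples and to the preimages of generators.\<close>

lemma chain_finite_subset: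
  assumes c: "is_chain L F A" and "finite S" "S \<subseteq> (\<Union>n. carrier (A n))"
  obtains n where "S \<subseteq> carrier (A n)"
proof -
  have "\<exists>n. S \<subseteq> carrier (A n)"
    using assms(2,3)
  proof (induction S)
    case (insert x S)
    then obtain m n where "S \<subseteq> carrier (A m)" "x \<in> carrier (A n)" by auto
    then have "insert x S \<subseteq> carrier (A (max m n))"
      using chain_substructure[OF c, of m "max m n"] chain_substructure[OF c, of n "max m n"]
      by (auto simp: substructure_def)
    then show ?case ..
  qed simp
  then show ?thesis using that by blast
qed

section \<open>Interpretation of symbols in the union of a chain\<close>

lemma carrier_chain_union: "carrier (chain_union L A) = (\<Union>n. carrier (A n))"
  by (simp add: chain_union_def)

text \<open>Removes the \<open>LEAST\<close> from the definition: the first member containing the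
  arguments is a substructure of \<open>A n\<close>, so both give the same value.\<close>

lemma fint_chain_union:
  assumes c: "is_chain L F A" and f: "f \<in> funs L" and xs: "xs \<in> tuples (far L f) (carrier (A n))"
  shows "fint (chain_union L A) f xs = fint (A n) f xs"
proof -
  let ?m = "LEAST n. set xs \<subseteq> carrier (A n)"
  have n: "set xs \<subseteq> carrier (A n)" using xs by (simp add: tuples_def)
  then have "set xs \<subseteq> carrier (A ?m)" and le: "?m \<le> n"
    by (rule LeastI[where P = "\<lambda>n. set xs \<subseteq> carrier (A n)"],
      rule Least_le[where P = "\<lambda>n. set xs \<subseteq> carrier (A n)"])
  then have m: "xs \<in> tuples (far L f) (carrier (A ?m))"
    using xs by (simp add: tuples_def)
  have "xs \<in> tuples (far L f) (\<Union>n. carrier (A n))"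
    using xs by (rule tuples_mono[rotated]) auto
  then have "fint (chain_union L A) f xs = fint (A ?m) f xs"
    using f by (simp add: chain_union_def)
  also have "\<dots> = fint (A n) f xs"
    using chain_substructure[OF c le] f m by (simp add: substructure_def)
  finally show ?thesis .
qed

lemma rint_chain_union:
  assumes c: "is_chain L F A" and r: "r \<in> rels L" and xs: "xs \<in> tuples (rar L r) (carrier (A n))"
  shows "xs \<in> rint (chain_union L A) r \<longleftrightarrow> xs \<in> rint (A n) r"
proof
  assume "xs \<in> rint (chain_union L A) r"
  then obtain m where m: "xs \<in> rint (A m) r" using r by (auto simp: chain_union_def)
  have "xs \<in> tuples (rar L r) (carrier (A m))"
    using chain_substructure[OF c order_refl] r m rint_tuples by (metis substructure_def)
  \<comment> \<open>The stage \<open>m\<close> at which the relation is witnessed may lie on either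
    side of \<open>n\<close>; both stages are compared inside the later one.\<close>
  then have "xs \<in> rint (A (max m n)) r"
    using chain_substructure[OF c, of m "max m n"] r m by (simp add: substructure_def)
  then show "xs \<in> rint (A n) r"
    using chain_substructure[OF c, of n "max m n"] r xs by (simp add: substructure_def)
qed (use r in \<open>auto simp: chain_union_def\<close>)

lemma is_struct_chain_union:
  assumes c: "is_chain L F A"
  shows "is_struct L (chain_union L A)"
proof -
  have A: "is_struct L (A n)" for n
    using chain_substructure[OF c order_refl] by (simp add: substructure_def)
  have "fint (chain_union L A) f xs \<in> carrier (chain_union L A)"
    if f: "f \<in> funs L" and xs: "xs \<in> tuples (far L f) (carrier (chain_union L A))" for f xs
  proof -
    have "set xs \<subseteq> (\<Union>n. carrier (A n))"
      using xs by (simp add: tuples_def carrier_chain_union)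
    then obtain n where "set xs \<subseteq> carrier (A n)"
      using chain_finite_subset[OF c finite_set] by metis
    then have n: "xs \<in> tuples (far L f) (carrier (A n))" using xs by (simp add: tuples_def)
    then show ?thesis
      using fint_closed[OF A f n] fint_chain_union[OF c f n] by (auto simp: carrier_chain_union)
  qed
  moreover have "rint (chain_union L A) r \<subseteq> tuples (rar L r) (carrier (chain_union L A))"
    if r: "r \<in> rels L" for r
    using r rint_tuples[OF A r] by (fastforce simp: chain_union_def tuples_def)
  moreover have "fint (chain_union L A) \<in> extensional (funs L)"
    "rint (chain_union L A) \<in> extensional (rels L)"
    "f \<in> funs L \<Longrightarrow>
      fint (chain_union L A) f \<in> extensional (tuples (far L f) (carrier (chain_union L A)))" for f
    by (simp_all add: chain_union_def)
  ultimately show ?thesis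
    by (auto simp: is_struct_def PiE_def Pi_def)
qed

lemma substructure_chain_union:
  assumes c: "is_chain L F A"
  shows "substructure L (A n) (chain_union L A)"
  using chain_substructure[OF c order_refl, of n] is_struct_chain_union[OF c]
    fint_chain_union[OF c] rint_chain_union[OF c]
  by (auto simp: substructure_def carrier_chain_union)

section \<open>Eve's strategies\<close>

text \<open>The rest of the position is already a legal chain, so a new move only has to be checked
  against the last structure played.\<close>

lemma eve_strategyI:
  assumes "s [] \<in> F"
    and "\<And>xs. xs \<noteq> [] \<Longrightarrow> last xs \<in> F \<Longrightarrow> s xs \<in> F \<and> substructure L (last xs) (s xs)"
  shows "eve_strategy L F s"
  unfolding eve_strategy_def
proof (intro allI impI)
  fix xs assume xs: "position L F xs \<and> even (length xs)"
  show "position L F (xs @ [s xs])"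
  proof (cases "xs = []")
    case True
    then show ?thesis using assms(1) by (simp add: position_def)
  next
    case False
    then have "last xs \<in> F" using xs by (auto simp: position_def)
    with assms(2)[OF False] show ?thesis
      using xs False by (simp add: position_def successively_append_iff)
  qed
qed

section \<open>Universality of \<open>G\<close>\<close>

lemma universal_if_Eve_not_winning:
  assumes F: "fg_class L F" and X: "X \<in> F" and noE: "\<not> (\<exists>s. eve_winning_strategy L F G s)"
  shows "\<exists>h. embedding L X G h"
proof (rule ccontr)
  assume no: "\<nexists>h. embedding L X G h"
  \<comment> \<open>After the opening Eve merely repeats the last structure, which is legal by
    reflexivity: \<open>X\<close> as first member already embeds into the union.\<close>
  define s where "s xs = (if xs = [] then X else last xs)" for xs
  have "eve_strategy L F s"
    using F X by (intro eve_strategyI) (auto simp: s_def fg_class_def intro!: substructure_refl)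
  moreover have "\<not> odd_wins L G A" if A: "is_chain L F A" "eve_follows s A" for A
  proof
    assume "odd_wins L G A"
    then obtain f where "embedding L (chain_union L A) G f"
      by (auto simp: odd_wins_def isomorphic_def)
    then have "embedding L (A 0) G f"
      by (rule embedding_substructure[OF substructure_chain_union[OF A(1)]])
    moreover have "A 0 = X" using A(2) by (simp add: eve_follows_def s_def)
    ultimately show False using no by blast
  qed
  ultimately show False using noE by (auto simp: eve_winning_strategy_def)
qed

section \<open>Spoiling moves and the extension property\<close>

lemma exists_spoiling_extension:
  fixes C A G :: "('f, 'r, 'a) struct"
  assumes U: "uncountable (UNIV :: 'a set)" and F: "fg_class L F"
    and A: "substructure L A G" and gen: "generates L A (set ss)"
    and bad: "\<And>B. B \<in> F \<Longrightarrow> substructure L A B \<Longrightarrow> substructure L B G \<Longrightarrow>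
      \<exists>X\<in>F. substructure L B X \<and> \<not> (\<exists>h. embedding L X G h \<and> (\<forall>a\<in>carrier A. h a = a))"
    and C: "C \<in> F" and ys: "set ys \<subseteq> carrier C"
  shows "\<exists>Y\<in>F. substructure L C Y \<and> \<not> (\<exists>h. embedding L Y G h \<and> map h ys = ss)"
proof (cases "\<exists>g. embedding L C G g \<and> map g ys = ss")
  \<comment> \<open>Nothing has to be spoiled here, so \<open>C\<close> itself serves as
    \<open>Y\<close>.\<close>
  case False
  then show ?thesis using C F by (auto simp: fg_class_def intro!: substructure_refl)
next
  case True
  then obtain g where g: "embedding L C G g" and gs: "map g ys = ss" by blast
  obtain B where B: "substructure L B G" "embedding L C B g" "carrier B = g ` carrier C"
    using g by (rule image_substructure)
  have BF: "B \<in> F" using F C B(2,3) unfolding fg_class_def isomorphic_def by metis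
  have "set ss \<subseteq> carrier B" using gs ys B(3) by (auto simp: subset_iff)
  then have AB: "substructure L A B" by (rule generated_substructure[OF gen A B(1)])
  then obtain X where X: "X \<in> F" "substructure L B X"
    and noX: "\<not> (\<exists>h. embedding L X G h \<and> (\<forall>a\<in>carrier A. h a = a))"
    using bad[OF BF _ B(1)] by blast
  have "countable (carrier C)" "countable (carrier X)"
    using F C X(1) by (auto simp: fg_class_def)
  then obtain Y t where Y: "embedding L X Y t" "carrier Y = t ` carrier X" "substructure L C Y"
    and tg: "\<And>c. c \<in> carrier C \<Longrightarrow> t (g c) = c"
    using pullback_extension[OF U _ _ B(2,3) X(2)] by metis
  have "Y \<in> F" using F X(1) Y(1,2) unfolding fg_class_def isomorphic_def by metis
  moreover have False if h: "embedding L Y G h" and hs: "map h ys = ss" for h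
  proof -
    have e: "embedding L X G (\<lambda>x. h (t x))" using embedding_comp[OF Y(1) h] .
    \<comment> \<open>On \<open>ys\<close> the map \<open>t\<close> undoes \<open>g\<close>, and
      \<open>h\<close> agrees with \<open>g\<close> because both send \<open>ys\<close> to
      \<open>ss\<close>. Thus \<open>h\<close> after \<open>t\<close> fixes the generators of
      \<open>A\<close>.\<close>
    have "\<forall>y\<in>set ys. h (t (g y)) = g y"
      using tg ys gs hs by (metis map_eq_conv subsetD)
    then have "\<forall>s\<in>set ss. h (t s) = s" using gs by auto
    moreover have "embedding L A G (\<lambda>x. h (t x))"
      using embedding_substructure[OF substructure_trans[OF AB X(2)] e] .
    ultimately have "\<forall>a\<in>carrier A. h (t a) = a"
      by (intro embedding_fixing_generators[OF gen A])
    with noX e show False by blast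
  qed
  ultimately show ?thesis using Y(3) by blast
qed

lemma extension_if_Eve_not_winning:
  fixes A G :: "('f, 'r, 'a) struct"
  assumes U: "uncountable (UNIV :: 'a set)" and F: "fg_class L F"
    and noE: "\<not> (\<exists>s. eve_winning_strategy L F G s)"
    and AF: "A \<in> F" and A: "substructure L A G"
  shows "\<exists>B\<in>F. substructure L A B \<and> substructure L B G \<and>
    (\<forall>X\<in>F. substructure L B X \<longrightarrow> (\<exists>h. embedding L X G h \<and> (\<forall>a\<in>carrier A. h a = a)))"
proof (rule ccontr)
  assume contra: "\<not> ?thesis"
  obtain S where "finite S" "generates L A S"
    using F AF unfolding fg_class_def finitely_generated_def generates_def by blast
  \<comment> \<open>A list rather than a set, so that \<open>map h ys = ss\<close> records which
    element is sent to which generator.\<close>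
  then obtain ss where gen: "generates L A (set ss)" using finite_list by metis
  \<comment> \<open>The guard on \<open>ys\<close> makes a spoiling move available for every list,
    so the strategy is total even where the decoded tuple does not lie in \<open>C\<close>.\<close>
  define spoils where "spoils C ys Y \<longleftrightarrow> Y \<in> F \<and> substructure L C Y \<and>
      (set ys \<subseteq> carrier C \<longrightarrow> \<not> (\<exists>h. embedding L Y G h \<and> map h ys = ss))" for C ys Y
  have ex: "\<exists>Y. spoils C ys Y" if C: "C \<in> F" for C ys
  proof (cases "set ys \<subseteq> carrier C")
    case True
    have "\<exists>Y\<in>F. substructure L C Y \<and> \<not> (\<exists>h. embedding L Y G h \<and> map h ys = ss)"
      by (rule exists_spoiling_extension[OF U F A gen _ C True]) (use contra in blast)
    then show ?thesis by (auto simp: spoils_def)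
  next
    case False
    then show ?thesis
      using C F by (auto simp: spoils_def fg_class_def intro!: substructure_refl exI[of _ C])
  qed
  \<comment> \<open>At her move number \<open>m + 1\<close>, with \<open>m\<close> coding \<open>(i, k)\<close>, Eve handles the \<open>k\<close>-th tuple from the
    \<open>i\<close>-th structure. It has already been played, since \<open>i \<le> m\<close>.\<close>
  define tuple where "tuple xs = (case prod_decode (length xs div 2 - 1) of
      (i, k) \<Rightarrow> from_nat_into (lists (carrier (xs ! i))) k)" for xs :: "('f, 'r, 'a) struct list"
  define s where "s xs = (if xs = [] then A else SOME Y. spoils (last xs) (tuple xs) Y)" for xs
  have s: "spoils (last xs) (tuple xs) (s xs)" if "xs \<noteq> []" "last xs \<in> F" for xs
    using someI_ex[OF ex[OF that(2)]] that(1) by (simp add: s_def)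
  have "eve_strategy L F s"
    using AF s by (intro eve_strategyI) (auto simp: s_def[of "[]"] spoils_def)
  moreover have "\<not> odd_wins L G P" if P: "is_chain L F P" "eve_follows s P" for P
  proof
    assume "odd_wins L G P"
    then obtain f where f: "embedding L (chain_union L P) G f"
      and surj: "f ` carrier (chain_union L P) = carrier G"
      by (auto simp: odd_wins_def isomorphic_def)
    define ys where "ys = map (inv_into (carrier (chain_union L P)) f) ss"
    have ss: "set ss \<subseteq> f ` carrier (chain_union L P)"
      using gen A surj by (auto simp: generates_def substructure_def)
    have fys: "map f ys = ss"
      using ss by (auto simp: ys_def f_inv_into_f intro!: map_idI)
    have "set ys \<subseteq> carrier (chain_union L P)"
      using ss by (auto simp: ys_def intro!: inv_into_into)
    then obtain i where i: "set ys \<subseteq> carrier (P i)"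
      using chain_finite_subset[OF P(1) finite_set] unfolding carrier_chain_union by metis
    have "countable (carrier (P i))"
      using P(1) F by (auto simp: is_chain_def fg_class_def)
    \<comment> \<open>Countability of \<open>P i\<close> makes its finite tuples enumerable, so
      \<open>ys\<close> has an index and its turn comes at a finite stage.\<close>
    then obtain k where k: "ys = from_nat_into (lists (carrier (P i))) k"
      using i from_nat_into_surj[of "lists (carrier (P i))" ys] by auto
    define m where "m = prod_encode (i, k)"
    \<comment> \<open>The even length makes it Eve's turn, and halving it minus one returns
      \<open>m\<close>. The last entry \<open>P (2 * m + 1)\<close> contains \<open>P i\<close>, so
      the guard in \<open>spoils\<close> is met.\<close>
    define xs where "xs = map P [0..<2 * m + 2]"
    have im: "i \<le> m" unfolding m_def by (rule le_prod_encode_1)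
    have xs: "xs \<noteq> []" "last xs = P (2 * m + 1)" "xs ! i = P i" "length xs div 2 - 1 = m"
      using im by (simp_all add: xs_def last_conv_nth del: upt_Suc)
    have "tuple xs = ys"
      using xs(3,4) k by (simp add: tuple_def m_def)
    moreover have "P (2 * m + 2) = s xs"
      using P(2) unfolding eve_follows_def xs_def by simp
    moreover have "P (2 * m + 1) \<in> F" using P(1) by (simp add: is_chain_def)
    moreover have "set ys \<subseteq> carrier (P (2 * m + 1))"
      using i chain_substructure[OF P(1), of i "2 * m + 1"] im by (auto simp: substructure_def)
    ultimately have "\<not> (\<exists>h. embedding L (P (2 * m + 2)) G h \<and> map h ys = ss)"
      using s[OF xs(1)] xs(2) by (simp add: spoils_def)
    moreover have "embedding L (P (2 * m + 2)) G f"
      using embedding_substructure[OF substructure_chain_union[OF P(1)] f] .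
    ultimately show False using fys by blast
  qed
  ultimately show False using noE by (auto simp: eve_winning_strategy_def)
qed

theorem theorem3p2:
  fixes L :: "('f, 'r) signature"
    and F :: "('f, 'r, 'a) struct set"
    and G :: "('f, 'r, 'a) struct"
  assumes "uncountable (UNIV :: 'a set)"
    and "countable_signature L"
    and "fg_class L F"
    and "G \<in> sigma_class L F"
    and "\<not> (\<exists>s. eve_winning_strategy L F G s)"
  shows "weakly_injective L F G"
  unfolding weakly_injective_def
  using assms(4) universal_if_Eve_not_winning[OF assms(3) _ assms(5)]
    extension_if_Eve_not_winning[OF assms(1,3,5)]
  by blast

end
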